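(* Let $A$ be an $m\times m$ nonsingular real matrix. Then the matrix $$\left(A^\top A-I\right)\operatorname{diag}(\operatorname{sgn}(x^+))+I$$ is nonsingular for all $x\in\mathbb{R}^m$. As a consequence, for every $z\in\mathbb{R}^m$, the semi-smooth Newton sequence $\{x_k\}$ given by $$\left(\left(A^\top A-I\right)\operatorname{diag}(\operatorname{sgn}(x_k^+))+I\right)x_{k+1}=A^\top z,\qquad k=0,1,2,\ldots,$$ is well defined from any starting point $x_0\in\mathbb{R}^m$ (that is, for each $x_0$ there is exactly one sequence with starting point $x_0$ satisfying these equations).
   Context: $I$ is the $m\times m$ identity matrix. For $x=(x^1,\dots,x^m)\in\mathbb{R}^m$, $x^+=(\max\{x^1,0\},\dots,\max\{x^m,0\})$; $\operatorname{sgn}(x)$ is the vector whose components are $1$, $0$ or $-1$ according to whether the corresponding component of $x$ is positive, zero or negative; $\operatorname{diag}(x)$ is the diagonal matrix with diagonal entries the components of $x$. So $\operatorname{diag}(\operatorname{sgn}(x^+))$ is diagonal with entries $1$ where $x^i>0$ and $0$ elsewhere. *)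

theory Defs
  imports "HOL-Analysis.Analysis"
begin

definition vec_pos_part :: "real ^ 'm \<Rightarrow> real ^ 'm" where
  "vec_pos_part x = (\<chi> i. max (x $ i) 0)"

text \<open>The componentwise sign. The overloaded \<^const>\<open>sgn\<close> cannot be used on vectors for this
  purpose: on a real normed vector space it is the normalisation \<open>x / norm x\<close>.\<close>

definition vec_sgn :: "real ^ 'm \<Rightarrow> real ^ 'm" where
  "vec_sgn x = (\<chi> i. sgn (x $ i))"

definition diag_mat :: "real ^ 'm \<Rightarrow> real ^ 'm ^ 'm" where
  "diag_mat x = (\<chi> i j. if i = j then x $ i else 0)"

definition newton_matrix :: "real ^ 'm ^ 'm \<Rightarrow> real ^ 'm \<Rightarrow> real ^ 'm ^ 'm" where
  "newton_matrix A x =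
     (transpose A ** A - mat 1) ** diag_mat (vec_sgn (vec_pos_part x)) + mat 1"

end

theory Submission
  imports Defs
begin

text \<open>If \<open>v\<close> is in the kernel of \<open>(A\<^sup>T A - I) D + I\<close> with \<open>D\<close> an orthogonal projection, put
  \<open>w = D v\<close> and take the inner product of \<open>A\<^sup>T A w - w + v = 0\<close> with \<open>w\<close>. Since \<open>w \<bullet> v = w \<bullet> w\<close>,
  this leaves \<open>\<parallel>A w\<parallel>\<^sup>2 = 0\<close>, hence \<open>w = 0\<close> and then \<open>v = 0\<close>.\<close>

lemma invertible_iff_ker_trivial:
  fixes M :: "real ^ 'n ^ 'n"
  shows "invertible M \<longleftrightarrow> (\<forall>v. M *v v = 0 \<longrightarrow> v = 0)"
  by (simp add: invertible_left_inverse matrix_left_invertible_ker)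

lemma invertible_gram_diff_mult_projection_add:
  fixes A D :: "real ^ 'm ^ 'm"
  assumes "invertible A"
    and D: "\<And>v. (D *v v) \<bullet> v = (D *v v) \<bullet> (D *v v)"
  shows "invertible ((transpose A ** A - mat 1) ** D + mat 1)"
  unfolding invertible_iff_ker_trivial
proof (intro allI impI)
  fix v assume "((transpose A ** A - mat 1) ** D + mat 1) *v v = 0"
  moreover define w where "w = D *v v"
  ultimately have ker: "transpose A *v (A *v w) - w + v = 0"
    by (simp add: matrix_vector_mult_add_rdistrib matrix_vector_mult_diff_rdistrib
        flip: matrix_vector_mul_assoc)
  have "(A *v w) \<bullet> (A *v w) = w \<bullet> (transpose A *v (A *v w))"
    by (metis dot_lmul_matrix inner_commute transpose_matrix_vector)
  also have "\<dots> = w \<bullet> (transpose A *v (A *v w) - w + v)"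
    using D[of v] by (simp add: w_def inner_add_right inner_diff_right)
  finally have "A *v w = 0"
    using ker by simp
  then have "w = 0"
    using \<open>invertible A\<close> by (simp add: invertible_iff_ker_trivial)
  with ker show "v = 0"
    by simp
qed

lemma diag_mat_mult_vec_nth: "(diag_mat d *v v) $ i = d $ i * v $ i"
  by (simp add: diag_mat_def matrix_vector_mult_def if_distrib[of "\<lambda>c. c * _"] cong: if_cong)

lemma invertible_newton_matrix:
  assumes "invertible A"
  shows "invertible (newton_matrix A x)"
  unfolding newton_matrix_def
proof (rule invertible_gram_diff_mult_projection_add[OF assms])
  fix v
  show "(diag_mat (vec_sgn (vec_pos_part x)) *v v) \<bullet> v =
    (diag_mat (vec_sgn (vec_pos_part x)) *v v) \<bullet> (diag_mat (vec_sgn (vec_pos_part x)) *v v)"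
    \<comment> \<open>Each diagonal entry \<open>d\<close> is 0 or 1, so \<open>d * d = d\<close>
      and the two sums agree term by term.\<close>
    by (auto simp: inner_vec_def diag_mat_mult_vec_nth vec_sgn_def vec_pos_part_def sgn_if
        intro!: sum.cong)
qed

text \<open>Turns the implicit Newton equation into an explicit formula for the next iterate, the
  form that \<open>ex1_iteration\<close> handles.\<close>

lemma invertible_mult_vec_eq_iff:
  fixes M :: "real ^ 'n ^ 'n"
  assumes "invertible M"
  shows "M *v y = b \<longleftrightarrow> y = matrix_inv M *v b"
proof -
  \<comment> \<open>\<open>matrix_inv\<close> is a Hilbert choice; invertibility provides the
    witness that makes it a two-sided inverse.\<close>
  have "M ** matrix_inv M = mat 1 \<and> matrix_inv M ** M = mat 1"
    unfolding matrix_inv_def using assms[unfolded invertible_def] by (rule someI_ex)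
  then show ?thesis
    by (metis matrix_vector_mul_assoc matrix_vector_mul_lid)
qed

lemma ex1_iteration: "\<exists>!X. X 0 = a \<and> (\<forall>k. X (Suc k) = f (X k))"
proof (rule ex1I)
  show "rec_nat a (\<lambda>_. f) 0 = a \<and> (\<forall>k. rec_nat a (\<lambda>_. f) (Suc k) = f (rec_nat a (\<lambda>_. f) k))"
    by simp
  fix X assume X: "X 0 = a \<and> (\<forall>k. X (Suc k) = f (X k))"
  have "X k = rec_nat a (\<lambda>_. f) k" for k
    by (induction k) (simp_all add: X)
  then show "X = rec_nat a (\<lambda>_. f)" ..
qed

theorem lemma5:
  fixes A :: "real ^ 'm ^ 'm"
  assumes "invertible A"
  shows "(\<forall>x :: real ^ 'm. invertible (newton_matrix A x)) \<and>
         (\<forall>z x0 :: real ^ 'm. \<exists>!X :: nat \<Rightarrow> real ^ 'm.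
            X 0 = x0 \<and>
            (\<forall>k. newton_matrix A (X k) *v X (Suc k) = transpose A *v z))"
  \<comment> \<open>The Newton step as a map of the current iterate; the placeholders are matched
    with \<open>x0\<close> and \<open>z\<close> once each equation is solved for
    \<open>X (Suc k)\<close>.\<close>
  using ex1_iteration[of _ "\<lambda>x. matrix_inv (newton_matrix A x) *v (transpose A *v _)"]
  by (simp add: invertible_newton_matrix[OF assms] invertible_mult_vec_eq_iff)

end
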